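(* Let $H$ be a Hermitian matrix with algebraic entries, associated with a Hermitian graph, with spectral decomposition $H=\sum_r\theta_rE_r$. Suppose perfect state transfer occurs from $a$ to $b$ with phase factor $\alpha$ (i.e., $U(\tau)e_a=\alpha e_b$ for some time $\tau$). If there exist integers $k_r$, for $\theta_r\in\Phi_a$, satisfying $$\sum_{\theta_r\in\Phi_a}k_r\theta_r=0\qquad\text{and}\qquad\sum_{\theta_r\in\Phi_a}k_r\neq0,$$ then $\alpha$ is algebraic.
   Context: $U(t)=e^{-itH}$. In the spectral decomposition, $\theta_r$ are the distinct eigenvalues and $E_r$ the orthogonal projections onto the eigenspaces. The eigenvalue support of $a$ is $\Phi_a=\{\theta_r:E_re_a\neq0\}$. Perfect state transfer from $a$ to $b$ at time $\tau$ with phase factor $\alpha$ means $U(\tau)e_a=\alpha e_b$ with $|\alpha|=1$. *)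

theory Defs
  imports "HOL-Analysis.Analysis" "HOL-Computational_Algebra.Polynomial"
begin

definition hermitian :: "complex ^ 'n ^ 'n \<Rightarrow> bool" where
  "hermitian H \<longleftrightarrow> map_matrix cnj (transpose H) = H"

text \<open>
  A Hermitian graph is a graph whose edges carry complex weights, the two directions of an edge
  carrying conjugate weights; the vertices are the elements of the index type. A matrix is
  associated with the graph if it is Hermitian and its off-diagonal support is exactly the edge
  set. The diagonal is left free, so that loop weights and Laplacian-type matrices are covered;
  conversely every Hermitian matrix is associated with the graph of its off-diagonal support.
\<close>

definition assoc_hermitian_graph :: "('n \<times> 'n) set \<Rightarrow> complex ^ 'n ^ 'n \<Rightarrow> bool" where
  "assoc_hermitian_graph E H \<longleftrightarrow>
     irrefl E \<and> sym E \<and> hermitian H \<and> (\<forall>u v. u \<noteq> v \<longrightarrow> (H $ u $ v \<noteq> 0 \<longleftrightarrow> (u, v) \<in> E))"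

text \<open>
  The library's \<^const>\<open>inner\<close> on \<^typ>\<open>complex ^ 'n\<close> is the real part of the
  following sesquilinear form (linear in the second argument).
\<close>

definition cinner :: "complex ^ 'n \<Rightarrow> complex ^ 'n \<Rightarrow> complex" where
  "cinner x y = (\<Sum>i\<in>UNIV. cnj (x $ i) * y $ i)"

text \<open>The power series is spelled out because \<^const>\<open>exp\<close> is not available for \<^const>\<open>matrix_matrix_mult\<close>.\<close>

definition mexp :: "complex ^ 'n ^ 'n \<Rightarrow> complex ^ 'n ^ 'n" where
  "mexp A = (\<Sum>k. (1 / fact k) *\<^sub>R (((**) A ^^ k) (mat 1)))"

definition transition :: "complex ^ 'n ^ 'n \<Rightarrow> real \<Rightarrow> complex ^ 'n ^ 'n" where
  "transition H t = mexp (map_matrix (\<lambda>z. - \<i> * of_real t * z) H)"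

definition eigenspace :: "complex ^ 'n ^ 'n \<Rightarrow> complex \<Rightarrow> (complex ^ 'n) set" where
  "eigenspace H \<theta> = {x. H *v x = \<theta> *s x}"

definition eigenvalues :: "complex ^ 'n ^ 'n \<Rightarrow> complex set" where
  "eigenvalues H = {\<theta>. \<exists>x. x \<noteq> 0 \<and> H *v x = \<theta> *s x}"

definition is_orth_proj :: "(complex ^ 'n) set \<Rightarrow> complex ^ 'n ^ 'n \<Rightarrow> bool" where
  "is_orth_proj V P \<longleftrightarrow> (\<forall>x. P *v x \<in> V \<and> (\<forall>y\<in>V. cinner y (x - P *v x) = 0))"

definition orth_proj :: "(complex ^ 'n) set \<Rightarrow> complex ^ 'n ^ 'n" where
  "orth_proj V = (THE P. is_orth_proj V P)"

definition eigenprojection :: "complex ^ 'n ^ 'n \<Rightarrow> complex \<Rightarrow> complex ^ 'n ^ 'n" where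
  "eigenprojection H \<theta> = orth_proj (eigenspace H \<theta>)"

definition eigenvalue_support :: "complex ^ 'n ^ 'n \<Rightarrow> 'n \<Rightarrow> complex set" where
  "eigenvalue_support H a = {\<theta> \<in> eigenvalues H. eigenprojection H \<theta> *v axis a 1 \<noteq> 0}"

definition perfect_state_transfer ::
    "complex ^ 'n ^ 'n \<Rightarrow> 'n \<Rightarrow> 'n \<Rightarrow> real \<Rightarrow> complex \<Rightarrow> bool" where
  "perfect_state_transfer H a b \<tau> \<alpha> \<longleftrightarrow>
     transition H \<tau> *v axis a 1 = \<alpha> *s axis b 1 \<and> cmod \<alpha> = 1"


text \<open>
  The remaining lemmas show that the series, the description and the finite sums involved are
  meaningful: the exponential series converges, orthogonal projections onto eigenspaces exist
  uniquely, and Hermitian matrices have finitely many eigenvalues.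
\<close>

lemma inner_eq_Re_cinner: "x \<bullet> y = Re (cinner x y)"
  by (simp add: inner_vec_def cinner_def inner_complex_def)

lemma cinner_add_right: "cinner x (y + z) = cinner x y + cinner x z"
  by (simp add: cinner_def algebra_simps sum.distrib)

lemma cinner_diff_right: "cinner x (y - z) = cinner x y - cinner x z"
  by (simp add: cinner_def algebra_simps sum_subtractf)

lemma cinner_scale_right: "cinner x (c *s y) = c * cinner x y"
  by (simp add: cinner_def sum_distrib_left algebra_simps)

lemma cinner_scale_left: "cinner (c *s x) y = cnj c * cinner x y"
  by (simp add: cinner_def sum_distrib_left algebra_simps)

lemma cinner_self_eq_0: "cinner x x = 0 \<Longrightarrow> x = 0"
  by (metis inner_eq_Re_cinner inner_eq_zero_iff zero_complex.sel(1))

lemma cinner_hermitian: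
  assumes "hermitian H"
  shows "cinner x (H *v y) = cinner (H *v x) y"
proof -
  have H: "cnj (H $ j $ i) = H $ i $ j" for i j
    using assms by (simp add: hermitian_def vec_eq_iff transpose_def)
  have "cinner x (H *v y) = (\<Sum>i\<in>UNIV. \<Sum>j\<in>UNIV. cnj (x $ i) * (H $ i $ j * y $ j))"
    unfolding cinner_def matrix_vector_mult_def by (simp add: sum_distrib_left)
  also have "\<dots> = (\<Sum>j\<in>UNIV. \<Sum>i\<in>UNIV. cnj (x $ i) * (H $ i $ j * y $ j))"
    by (rule sum.swap)
  also have "\<dots> = cinner (H *v x) y"
    unfolding cinner_def matrix_vector_mult_def by (intro sum.cong refl) (auto simp: sum_distrib_right H intro!: sum.cong)
  finally show ?thesis .
qed

lemma eigenvalue_real: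
  assumes "hermitian H" "\<theta> \<in> eigenvalues H"
  shows "cnj \<theta> = \<theta>"
proof -
  obtain x where x: "x \<noteq> 0" "H *v x = \<theta> *s x"
    using assms(2) by (auto simp: eigenvalues_def)
  have "\<theta> * cinner x x = cnj \<theta> * cinner x x"
    using cinner_hermitian[OF assms(1), of x x] x
    by (simp add: cinner_scale_left cinner_scale_right)
  then show ?thesis using x cinner_self_eq_0 by auto
qed

lemma finite_eigenvalues:
  assumes "hermitian H"
  shows "finite (eigenvalues H)"
proof -
  define f where "f \<theta> = (SOME x. x \<noteq> 0 \<and> H *v x = \<theta> *s x)" for \<theta>
  have f: "f \<theta> \<noteq> 0 \<and> H *v f \<theta> = \<theta> *s f \<theta>" if "\<theta> \<in> eigenvalues H" for \<theta>
    using that unfolding f_def eigenvalues_def mem_Collect_eq by (rule someI_ex)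
  have orth: "cinner (f \<theta>) (f \<eta>) = 0"
    if "\<theta> \<in> eigenvalues H" "\<eta> \<in> eigenvalues H" "\<theta> \<noteq> \<eta>" for \<theta> \<eta>
  proof -
    have "\<eta> * cinner (f \<theta>) (f \<eta>) = \<theta> * cinner (f \<theta>) (f \<eta>)"
      using cinner_hermitian[OF assms, of "f \<theta>" "f \<eta>"] f that eigenvalue_real[OF assms that(1)]
      by (simp add: cinner_scale_left cinner_scale_right)
    then show ?thesis using that by simp
  qed
  have inj: "inj_on f (eigenvalues H)"
    by (rule inj_onI) (metis orth f cinner_self_eq_0)
  have "finite (f ` eigenvalues H)"
    by (rule pairwise_orthogonal_imp_finite)
      (use orth in \<open>fastforce simp: pairwise_def orthogonal_def inner_eq_Re_cinner\<close>)
  then show ?thesis using inj finite_imageD by blast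
qed

lemma is_orth_proj_unique:
  assumes V: "vec.subspace V" and "is_orth_proj V P" "is_orth_proj V Q"
  shows "P = Q"
proof -
  have "P *v x = Q *v x" for x
  proof -
    have "P *v x - Q *v x \<in> V"
      using assms by (simp add: is_orth_proj_def vec.subspace_diff)
    then have "cinner (P *v x - Q *v x) ((x - Q *v x) - (x - P *v x)) = 0"
      using assms(2,3) unfolding is_orth_proj_def by (subst cinner_diff_right) simp
    then show ?thesis using cinner_self_eq_0 by fastforce
  qed
  then show ?thesis by (simp add: matrix_eq)
qed

lemma is_orth_proj_exists:
  fixes V :: "(complex ^ 'n) set"
  assumes V: "vec.subspace V"
  shows "\<exists>P. is_orth_proj V P"
proof -
  have scaleR: "r *\<^sub>R x = complex_of_real r *s x" for r and x :: "complex ^ 'n"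
    unfolding vec_eq_iff by (simp add: complex_eq_iff)
  have "subspace V"
    using V by (auto simp: subspace_def scaleR vec.subspace_def)
  then have span: "span V = V" by simp
  have "\<exists>y. y \<in> V \<and> (\<forall>w\<in>V. cinner w (x - y) = 0)" for x
  proof -
    obtain y z where yz: "y \<in> span V" "\<And>w. w \<in> span V \<Longrightarrow> orthogonal z w" "x = y + z"
      using orthogonal_subspace_decomp_exists[of V x] by metis
    have "cinner w z = 0" if "w \<in> V" for w
    proof -
      have "\<i> *s w \<in> V" using V that by (simp add: vec.subspace_scale)
      then have "Re (cinner w z) = 0" "Re (cinner (\<i> *s w) z) = 0"
        using yz(2) that span
        by (metis inner_commute inner_eq_Re_cinner orthogonal_def)+
      then show ?thesis by (simp add: cinner_scale_left complex_eq_iff)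
    qed
    then show ?thesis using yz span by auto
  qed
  then obtain p where p: "p x \<in> V" "\<And>w. w \<in> V \<Longrightarrow> cinner w (x - p x) = 0" for x
    by metis
  have uniq: "p x = y" if "y \<in> V" "\<And>w. w \<in> V \<Longrightarrow> cinner w (x - y) = 0" for x y
  proof -
    have "p x - y \<in> V" using p that V by (simp add: vec.subspace_diff)
    then have "cinner (p x - y) ((x - y) - (x - p x)) = 0"
      using p(2)[of _ x] that(2) by (subst cinner_diff_right) simp
    then show ?thesis using cinner_self_eq_0 by fastforce
  qed
  have "Vector_Spaces.linear (*s) (*s) p"
  proof (rule Vector_Spaces.linear.intro)
    show "module_hom (*s) (*s) p"
    proof (intro module_hom.intro module_hom_axioms.intro)
      show "p (x + y) = p x + p y" for x y
      proof (rule uniq)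
        show "p x + p y \<in> V" using p V by (simp add: vec.subspace_add)
        show "cinner w (x + y - (p x + p y)) = 0" if "w \<in> V" for w
          using p(2)[OF that, of x] p(2)[OF that, of y]
          by (simp add: cinner_diff_right cinner_add_right)
      qed
      show "p (c *s x) = c *s p x" for c x
      proof (rule uniq)
        show "c *s p x \<in> V" using p V by (simp add: vec.subspace_scale)
        show "cinner w (c *s x - c *s p x) = 0" if "w \<in> V" for w
          using p(2)[OF that, of x]
          by (simp add: cinner_diff_right cinner_scale_right)
      qed
    qed unfold_locales
  qed unfold_locales
  then have "matrix p *v x = p x" for x by (rule matrix_works)
  then have "is_orth_proj V (matrix p)" using p by (simp add: is_orth_proj_def)
  then show ?thesis ..
qed

lemma is_orth_proj_eigenprojection: "is_orth_proj (eigenspace H \<theta>) (eigenprojection H \<theta>)"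
proof -
  have "vec.subspace (eigenspace H \<theta>)"
    by (simp add: vec.subspace_def eigenspace_def matrix_vector_right_distrib vec.scale_right_distrib
        vector_scalar_commute vec.scale_left_commute)
  then show ?thesis
    unfolding eigenprojection_def orth_proj_def
    using is_orth_proj_exists is_orth_proj_unique by (metis theI)
qed

lemma mexp_sums: "(\<lambda>k. (1 / fact k) *\<^sub>R (((**) A ^^ k) (mat 1))) sums mexp A"
  for A :: "complex ^ 'n ^ 'n"
proof -
  define m where "m = (\<Sum>i\<in>UNIV. \<Sum>j\<in>UNIV. cmod (A $ i $ j))"
  have row: "(\<Sum>j\<in>UNIV. cmod (A $ i $ j)) \<le> m" for i
    unfolding m_def by (rule member_le_sum) (auto intro: sum_nonneg)
  have m0: "m \<ge> 0" unfolding m_def by (intro sum_nonneg) auto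
  have entry: "cmod ((((**) A ^^ k) (mat 1)) $ i $ j) \<le> m ^ k" for k i j
  proof (induction k arbitrary: i j)
    case 0
    show ?case by (simp add: mat_def)
  next
    case (Suc k)
    let ?B = "((**) A ^^ k) (mat 1)"
    have "cmod ((((**) A ^^ Suc k) (mat 1)) $ i $ j) = cmod (\<Sum>l\<in>UNIV. A $ i $ l * ?B $ l $ j)"
      by (simp add: matrix_matrix_mult_def)
    also have "\<dots> \<le> (\<Sum>l\<in>UNIV. cmod (A $ i $ l) * m ^ k)"
      by (rule order_trans[OF norm_sum], rule sum_mono)
        (use Suc in \<open>auto simp: norm_mult intro!: mult_left_mono\<close>)
    also have "\<dots> = (\<Sum>l\<in>UNIV. cmod (A $ i $ l)) * m ^ k"
      by (simp add: sum_distrib_right)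
    also have "\<dots> \<le> m * m ^ k"
      by (intro mult_right_mono row zero_le_power m0)
    finally show ?case by simp
  qed
  let ?s = "\<lambda>k. (1 / fact k) *\<^sub>R (((**) A ^^ k) (mat 1))"
  let ?n = "real CARD('n)"
  have nrm: "norm (?s k) \<le> ?n * ?n * (m ^ k / fact k)" for k
  proof -
    have "norm (?s k) \<le> (\<Sum>i\<in>UNIV. \<Sum>j\<in>UNIV. cmod (?s k $ i $ j))"
      unfolding norm_vec_def
      by (rule order_trans[OF L2_set_le_sum]) (auto intro!: sum_mono L2_set_le_sum simp: L2_set_nonneg)
    also have "\<dots> \<le> (\<Sum>i\<in>(UNIV::'n set). \<Sum>j\<in>(UNIV::'n set). m ^ k / fact k)"
      by (intro sum_mono) (use entry[of k] in \<open>simp add: divide_right_mono\<close>)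
    finally show ?thesis by simp
  qed
  have "summable (\<lambda>k. ?n * ?n * (m ^ k / fact k))"
    using summable_exp[of m] by (intro summable_mult) (simp add: divide_inverse mult.commute)
  then have "summable ?s"
    by (rule summable_comparison_test[rotated]) (use nrm in auto)
  then show ?thesis unfolding mexp_def by (rule summable_sums)
qed

end

theory Submission
  imports Defs
begin

text \<open>
  An eigenvector \<open>y\<close> for an eigenvalue \<open>\<theta>\<close> in the support of \<open>a\<close> can be chosen with algebraic
  entries and \<open>y $ a = 1\<close>: the vector \<open>E\<^sub>\<theta> e\<^sub>a\<close> has \<open>a\<close>-entry equal to its squared norm, hence nonzero, and a
  linear system with algebraic coefficients that is solvable over the complex numbers is solvable
  over the algebraic numbers. Pairing \<open>U(\<tau>) e\<^sub>a = \<alpha> e\<^sub>b\<close> with \<open>y\<close> gives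
  \<open>exp (- \<i> \<tau> \<theta>) = c\<^sub>\<theta> \<alpha>\<close> with \<open>c\<^sub>\<theta> = cnj (y $ b)\<close> algebraic. In the product of the \<open>k\<^sub>\<theta>\<close>-th powers of
  these equations the exponentials cancel, which leaves a nonzero integer power of \<open>\<alpha>\<close> equal to an
  algebraic number.

  That sums, products and eigenvalues of algebraic numbers are algebraic comes from one criterion:
  a number is algebraic if multiplication by it preserves a nonzero finite-dimensional rational
  subspace of the field.
\<close>

section \<open>Rational spans and a criterion for algebraicity\<close>

interpretation rat_span: vector_space "\<lambda>(q::rat) (x::'a::field_char_0). of_rat q * x"
  by unfold_locales (simp_all add: of_rat_add of_rat_mult algebra_simps)

text \<open>Linearity reduces the claim to generators. Source and target are kept separate because
  multiplication is also used to pass from one span into another.\<close>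

lemma rat_span_mult:
  assumes "\<And>b. b \<in> B \<Longrightarrow> c * b \<in> rat_span.span S" and "v \<in> rat_span.span B"
  shows "c * v \<in> rat_span.span S"
  using assms(2)
proof (induction rule: rat_span.span_induct_alt)
  case base
  show ?case by (simp add: rat_span.span_zero)
next
  case (step q b v)
  have "of_rat q * (c * b) + c * v \<in> rat_span.span S"
    using assms(1) step by (intro rat_span.span_add rat_span.span_scale)
  then show ?case by (simp add: algebra_simps)
qed

text \<open>The products of \<open>w\<close> with the powers of \<open>x\<close> all lie in one
  finite-dimensional rational space, so finitely many of them satisfy a nontrivial rational
  relation. Cancelling \<open>w\<close> turns it into a polynomial equation for
  \<open>x\<close>.\<close>

lemma algebraic_if_stable_span:
  fixes x :: "'a :: field_char_0"
  assumes "finite B" and w: "w \<in> rat_span.span B" "w \<noteq> 0"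
    and stable: "\<And>v. v \<in> rat_span.span B \<Longrightarrow> x * v \<in> rat_span.span B"
  shows "algebraic x"
proof -
  define f where "f i = x ^ i * w" for i
  have f: "f i \<in> rat_span.span B" for i
    by (induction i) (use w stable in \<open>auto simp: f_def mult.assoc\<close>)
  define n where "n = card B"
  show ?thesis
  \<comment> \<open>The dimension bound counts a set, so it applies when the \<open>n + 1\<close>
    products are distinct. A repetition directly gives a difference of two monomials vanishing at
    \<open>x\<close>.\<close>
  proof (cases "inj_on f {..n}")
    case False
    then obtain i j where ij: "i \<noteq> j" "f i = f j"
      by (auto simp: inj_on_def)
    then have "poly (monom 1 i - monom 1 j) x = 0"
      using w by (simp add: f_def poly_monom)
    moreover have "monom (1::'a) i - monom 1 j \<noteq> 0"
      using ij by (simp add: poly_eq_iff) (metis zero_neq_one)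
    ultimately show ?thesis
      by (intro algebraicI[of "monom 1 i - monom 1 j"]) auto
  next
    case True
    have "rat_span.dependent (f ` {..n})"
    proof (rule ccontr)
      assume "\<not> rat_span.dependent (f ` {..n})"
      then have "card (f ` {..n}) \<le> card B"
        using rat_span.independent_span_bound[OF \<open>finite B\<close>] f by blast
      then show False using True by (simp add: card_image n_def)
    qed
    then obtain u where u: "\<exists>v\<in>f ` {..n}. u v \<noteq> 0" "(\<Sum>v\<in>f ` {..n}. of_rat (u v) * v) = 0"
      by (auto simp: rat_span.dependent_finite)
    define p where "p = (\<Sum>i\<le>n. monom (of_rat (u (f i)) :: 'a) i)"
    have coeff: "coeff p i = (if i \<le> n then of_rat (u (f i)) else 0)" for i
      by (simp add: p_def coeff_sum)
    have "poly p x * w = (\<Sum>i\<le>n. of_rat (u (f i)) * f i)"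
      by (simp add: p_def poly_sum poly_monom f_def sum_distrib_right mult.assoc)
    also have "\<dots> = 0"
      using u(2) True by (simp add: sum.reindex)
    finally have "poly p x = 0" using w by simp
    moreover have "p \<noteq> 0"
      using u(1) coeff by (metis (no_types, lifting) atMost_iff coeff_0 imageE of_rat_eq_0_iff)
    ultimately show ?thesis
      by (intro algebraicI'[of p]) (auto simp: coeff)
  qed
qed

text \<open>Numbers are adjoined one at a time. If \<open>B\<close> serves for \<open>A\<close> and
  \<open>p\<close> annihilates \<open>a\<close>, the products \<open>b * a ^ i\<close> with
  \<open>i\<close> below the degree of \<open>p\<close> serve for \<open>insert a A\<close>:
  elements of \<open>A\<close> act on the factor \<open>b\<close>, while \<open>a\<close> raises the
  exponent.\<close>

lemma algebraic_stable_span_exists: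
  fixes A :: "'a :: field_char_0 set"
  assumes "finite A" "\<And>a. a \<in> A \<Longrightarrow> algebraic a"
  shows "\<exists>B. finite B \<and> 1 \<in> B \<and> (\<forall>a\<in>A. \<forall>v\<in>rat_span.span B. a * v \<in> rat_span.span B)"
  using assms
proof (induction A rule: finite_induct)
  case empty
  show ?case by (intro exI[of _ "{1}"]) auto
next
  case (insert a A)
  then obtain B where B: "finite B" "1 \<in> B"
    "\<And>c v. c \<in> A \<Longrightarrow> v \<in> rat_span.span B \<Longrightarrow> c * v \<in> rat_span.span B"
    by auto
  have "algebraic a" using insert by simp
  then obtain p where p: "\<And>i. coeff p i \<in> \<rat>" "p \<noteq> 0" "poly p a = 0"
    unfolding algebraic_altdef by blast
  define n where "n = degree p"
  \<comment> \<open>Positive degree admits the exponent 0, which keeps 1 in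
    \<open>C\<close>.\<close>
  have "n \<noteq> 0"
  proof
    assume "n = 0"
    then obtain q where "p = [:q:]" unfolding n_def by (rule degree_eq_zeroE)
    then show False using p(2,3) by simp
  qed
  define C where "C = (\<lambda>(b, i). b * a ^ i) ` (B \<times> {..<n})"
  have C: "b * a ^ i \<in> rat_span.span C" if "b \<in> B" "i < n" for b i
    using that by (intro rat_span.span_base) (auto simp: C_def)
  have span_C: "a ^ i * v \<in> rat_span.span C" if "v \<in> rat_span.span B" "i < n" for v i
    by (rule rat_span_mult[OF _ that(1)]) (use C that in \<open>simp add: mult.commute\<close>)
  \<comment> \<open>The one exponent that leaves the range is reduced by solving \<open>p\<close>
    for its leading power; quotients of its coefficients are rational.\<close>
  have a_n: "b * a ^ n \<in> rat_span.span C" if "b \<in> B" for b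
  proof -
    have "(\<Sum>i\<le>n. coeff p i * a ^ i) = 0"
      using p(3) by (simp add: poly_altdef n_def)
    then have "coeff p n * a ^ n = (\<Sum>i<n. - coeff p i * a ^ i)"
      by (simp add: lessThan_Suc_atMost[symmetric] sum_negf add_eq_0_iff)
    then have "a ^ n = (\<Sum>i<n. - coeff p i * a ^ i) / coeff p n"
      using p(2) by (simp add: n_def field_simps)
    then have "b * a ^ n = (\<Sum>i<n. - (coeff p i / coeff p n) * (b * a ^ i))"
      by (simp add: sum_divide_distrib sum_distrib_left sum_negf algebra_simps)
    also have "\<dots> \<in> rat_span.span C"
    proof (rule rat_span.span_sum)
      fix i assume "i \<in> {..<n}"
      moreover have "- (coeff p i / coeff p n) \<in> \<rat>" using p(1) by auto
      then obtain q where "- (coeff p i / coeff p n) = of_rat q" by (rule Rats_cases)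
      ultimately show "- (coeff p i / coeff p n) * (b * a ^ i) \<in> rat_span.span C"
        using C[OF that] rat_span.span_scale by auto
    qed
    finally show ?thesis .
  qed
  have "c * d \<in> rat_span.span C" if "c \<in> insert a A" "d \<in> C" for c d
  proof -
    obtain b i where d: "d = b * a ^ i" "b \<in> B" "i < n" using \<open>d \<in> C\<close> by (auto simp: C_def)
    show ?thesis
    proof (cases "c = a")
      case True
      then have cd: "c * d = b * a ^ Suc i" by (simp add: d)
      show ?thesis
      proof (cases "Suc i = n")
        case True
        then show ?thesis using a_n d cd by metis
      next
        case False
        then show ?thesis using C d cd by (metis Suc_lessI)
      qed
    next
      case False
      then have "a ^ i * (c * b) \<in> rat_span.span C"
        using that d B(3) rat_span.span_base by (intro span_C) auto
      then show ?thesis by (simp add: d mult_ac)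
    qed
  qed
  then have "\<forall>c\<in>insert a A. \<forall>v\<in>rat_span.span C. c * v \<in> rat_span.span C"
    using rat_span_mult by blast
  moreover have "finite C" using B by (simp add: C_def)
  moreover have "1 \<in> C"
    unfolding C_def by (rule image_eqI[of _ _ "(1, 0)"]) (use B \<open>n \<noteq> 0\<close> in auto)
  ultimately show ?case by blast
qed

section \<open>Closure properties of algebraic numbers\<close>

lemma algebraic_add [intro]: "algebraic (x + y)"
  and algebraic_mult [intro]: "algebraic (x * y)"
  if "algebraic x" "algebraic y" for x y :: "'a :: field_char_0"
proof -
  \<comment> \<open>A span stable under both \<open>x\<close> and \<open>y\<close> is stable under
    their sum and product; 1 is its nonzero element.\<close>
  have "\<exists>B. finite B \<and> 1 \<in> B \<and>
      (\<forall>a\<in>{x, y}. \<forall>v\<in>rat_span.span B. a * v \<in> rat_span.span B)"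
    by (rule algebraic_stable_span_exists) (use that in auto)
  then obtain B where B: "finite B" "1 \<in> B"
    and stable: "\<forall>a\<in>{x, y}. \<forall>v\<in>rat_span.span B. a * v \<in> rat_span.span B"
    by (elim exE conjE)
  have 1: "1 \<in> rat_span.span B" using B by (intro rat_span.span_base)
  show "algebraic (x + y)"
    by (rule algebraic_if_stable_span[OF B(1) 1]) (simp_all add: distrib_right stable rat_span.span_add)
  show "algebraic (x * y)"
    by (rule algebraic_if_stable_span[OF B(1) 1]) (simp_all add: mult.assoc stable)
qed

lemma algebraic_diff [intro]:
  "algebraic x \<Longrightarrow> algebraic y \<Longrightarrow> algebraic (x - y)" for x y :: "'a :: field_char_0"
  using algebraic_add[of x "- y"] by simp

lemma algebraic_divide [intro]:
  "algebraic x \<Longrightarrow> algebraic y \<Longrightarrow> algebraic (x / y)" for x y :: "'a :: field_char_0"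
  by (simp add: divide_inverse algebraic_mult algebraic_inverse)

lemma algebraic_sum [intro]: "(\<And>i. i \<in> I \<Longrightarrow> algebraic (f i)) \<Longrightarrow> algebraic (sum f I)"
  for f :: "'i \<Rightarrow> 'a :: field_char_0"
  by (induction I rule: infinite_finite_induct) auto

lemma algebraic_prod [intro]: "(\<And>i. i \<in> I \<Longrightarrow> algebraic (f i)) \<Longrightarrow> algebraic (prod f I)"
  for f :: "'i \<Rightarrow> 'a :: field_char_0"
  by (induction I rule: infinite_finite_induct) auto

lemma algebraic_power [intro]: "algebraic x \<Longrightarrow> algebraic (x ^ n)" for x :: "'a :: field_char_0"
  by (induction n) auto

text \<open>For the converse, the exponent is nonzero, so up to inversion \<open>x\<close> is a root
  of positive order of an algebraic number.\<close>

lemma algebraic_power_int_iff: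
  fixes x :: "'a :: field_char_0"
  assumes "n \<noteq> 0"
  shows "algebraic (x powi n) \<longleftrightarrow> algebraic x"
proof
  show "algebraic x \<Longrightarrow> algebraic (x powi n)"
    by (auto simp: power_int_def)
next
  assume *: "algebraic (x powi n)"
  define m where "m = nat \<bar>n\<bar>"
  have "x powi n = x ^ m \<or> x powi n = inverse (x ^ m)"
    by (auto simp: power_int_def m_def power_inverse)
  then have "algebraic (x ^ m)" using * algebraic_inverse by fastforce
  moreover have "m > 0" using assms by (simp add: m_def)
  ultimately show "algebraic x"
    by (intro algebraic_root[of "x ^ m" "monom 1 m" x]) (auto simp: poly_monom degree_monom_eq)
qed

section \<open>Eigenvalues and linear systems over the algebraic numbers\<close>

text \<open>Take an eigenvector \<open>x\<close> and generators \<open>b\<close> of a rational span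
  stable under the entries of \<open>H\<close>. On the span of the products
  \<open>b * x $ j\<close>, multiplication by \<theta> can be carried out by \<open>H\<close> and
  hence stays inside.\<close>

lemma algebraic_eigenvalue:
  fixes H :: "complex ^ 'n ^ 'n"
  assumes H: "\<And>u v. algebraic (H $ u $ v)" and "\<theta> \<in> eigenvalues H"
  shows "algebraic \<theta>"
proof -
  obtain x where x: "x \<noteq> 0" "H *v x = \<theta> *s x"
    using assms(2) by (auto simp: eigenvalues_def)
  obtain i where i: "x $ i \<noteq> 0" using x(1) by (auto simp: vec_eq_iff)
  define A where "A = (\<lambda>(u, v). H $ u $ v) ` UNIV"
  have "finite A" unfolding A_def by simp
  moreover have "algebraic c" if "c \<in> A" for c using that H by (auto simp: A_def)
  ultimately obtain B where B: "finite B" "1 \<in> B"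
    "\<And>c v. c \<in> A \<Longrightarrow> v \<in> rat_span.span B \<Longrightarrow> c * v \<in> rat_span.span B"
    using algebraic_stable_span_exists[of A] by meson
  define C where "C = (\<lambda>(b, j). b * x $ j) ` (B \<times> UNIV)"
  have C: "b * x $ j \<in> rat_span.span C" if "b \<in> rat_span.span B" for b j
  proof -
    have "x $ j * d \<in> rat_span.span C" if "d \<in> B" for d
      using that by (intro rat_span.span_base) (auto simp: C_def mult.commute)
    from rat_span_mult[OF this that] show ?thesis by (simp add: mult.commute)
  qed
  have "\<theta> * c \<in> rat_span.span C" if "c \<in> C" for c
  proof -
    obtain b j where c: "c = b * x $ j" "b \<in> B" using \<open>c \<in> C\<close> by (auto simp: C_def)
    have "\<theta> * x $ j = (\<Sum>l\<in>UNIV. H $ j $ l * x $ l)"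
      using arg_cong[OF x(2), of "\<lambda>v. v $ j"] by (simp add: matrix_vector_mult_def)
    then have "\<theta> * c = (\<Sum>l\<in>UNIV. H $ j $ l * b * x $ l)"
      by (simp add: c mult.left_commute[of \<theta>] sum_distrib_left mult_ac)
    also have "\<dots> \<in> rat_span.span C"
    proof (intro rat_span.span_sum C B(3))
      show "H $ j $ l \<in> A" for l by (auto simp: A_def)
      show "b \<in> rat_span.span B" using c by (intro rat_span.span_base)
    qed
    finally show ?thesis .
  qed
  then have "\<theta> * v \<in> rat_span.span C" if "v \<in> rat_span.span C" for v
    using rat_span_mult that by blast
  moreover have "1 * x $ i \<in> rat_span.span C"
    using B(2) by (intro C rat_span.span_base)
  moreover have "finite C" using B(1) by (simp add: C_def)
  ultimately show ?thesis using i by (intro algebraic_if_stable_span[of C "1 * x $ i"]) auto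
qed

text \<open>
  By induction on the unknowns: an unknown whose value is an algebraic affine combination of the
  previous ones is replaced by the same combination of their new values; any other unknown has
  coefficient zero in every relation, so its new value is arbitrary.
\<close>

lemma algebraic_solution_exists:
  fixes x :: "'i \<Rightarrow> 'a :: field_char_0"
  assumes "finite I"
  shows "\<exists>y. (\<forall>i\<in>I. algebraic (y i)) \<and>
    (\<forall>c d. algebraic d \<longrightarrow> (\<forall>i\<in>I. algebraic (c i)) \<longrightarrow>
      (\<Sum>i\<in>I. c i * x i) = d \<longrightarrow> (\<Sum>i\<in>I. c i * y i) = d)"
  using assms
proof (induction I rule: finite_induct)
  case empty
  show ?case by simp
next
  case (insert j I)
  obtain y where y: "\<forall>i\<in>I. algebraic (y i)"
    "\<forall>c d. algebraic d \<longrightarrow> (\<forall>i\<in>I. algebraic (c i)) \<longrightarrow>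
      (\<Sum>i\<in>I. c i * x i) = d \<longrightarrow> (\<Sum>i\<in>I. c i * y i) = d"
    using insert.IH by (elim exE conjE)
  have upd: "(\<Sum>i\<in>insert j I. c i * (y(j := z)) i) = c j * z + (\<Sum>i\<in>I. c i * y i)" for c z
    using insert by (auto intro!: sum.cong)
  show ?case
  proof (cases "\<exists>e f. algebraic e \<and> (\<forall>i\<in>I. algebraic (f i)) \<and> x j = e + (\<Sum>i\<in>I. f i * x i)")
    case True
    then obtain e f where ef: "algebraic e" "\<And>i. i \<in> I \<Longrightarrow> algebraic (f i)"
      "x j = e + (\<Sum>i\<in>I. f i * x i)" by blast
    define z where "z = e + (\<Sum>i\<in>I. f i * y i)"
    show ?thesis
    proof (intro exI[of _ "y(j := z)"] conjI allI impI ballI)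
      show "algebraic ((y(j := z)) i)" if "i \<in> insert j I" for i
      proof (cases "i = j")
        case True
        have "algebraic z"
          unfolding z_def using y(1) ef(1,2) by (intro algebraic_add algebraic_sum algebraic_mult) auto
        then show ?thesis using True by simp
      qed (use that y(1) in auto)
      show "(\<Sum>i\<in>insert j I. c i * (y(j := z)) i) = d"
        if "algebraic d" "\<forall>i\<in>insert j I. algebraic (c i)" "(\<Sum>i\<in>insert j I. c i * x i) = d" for c d
      proof -
        have "(\<Sum>i\<in>I. (c j * f i + c i) * x i) = d - c j * e"
          using that(3) insert
          by (simp add: ef(3) algebra_simps sum.distrib sum_distrib_left)
        then have "(\<Sum>i\<in>I. (c j * f i + c i) * y i) = d - c j * e"
          using that ef by (intro y(2)[rule_format]) auto
        then show ?thesis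
          unfolding upd by (simp add: z_def algebra_simps sum.distrib sum_distrib_left)
      qed
    qed
  next
    case False
    show ?thesis
    proof (intro exI[of _ "y(j := 0)"] conjI allI impI ballI)
      show "algebraic ((y(j := 0)) i)" if "i \<in> insert j I" for i
        using that y(1) by auto
      show "(\<Sum>i\<in>insert j I. c i * (y(j := 0)) i) = d"
        if "algebraic d" "\<forall>i\<in>insert j I. algebraic (c i)" "(\<Sum>i\<in>insert j I. c i * x i) = d" for c d
      proof -
        have d: "c j * x j + (\<Sum>i\<in>I. c i * x i) = d"
          using that(3) insert by simp
        have "c j = 0"
        proof (rule ccontr)
          assume "c j \<noteq> 0"
          then have "x j = d / c j + (\<Sum>i\<in>I. - (c i / c j) * x i)"
            by (simp add: d[symmetric] add_divide_distrib sum_divide_distrib sum_negf)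
          moreover have "algebraic (d / c j)" "\<forall>i\<in>I. algebraic (- (c i / c j))"
            using that by auto
          ultimately have "\<exists>e f. algebraic e \<and> (\<forall>i\<in>I. algebraic (f i)) \<and>
              x j = e + (\<Sum>i\<in>I. f i * x i)"
            by (intro exI[of _ "d / c j"] exI[of _ "\<lambda>i. - (c i / c j)"] conjI)
          with False show False by (rule notE)
        qed
        then show ?thesis unfolding upd using d that y(2) by simp
      qed
    qed
  qed
qed

section \<open>The transition matrix and eigenvectors\<close>

text \<open>Self-adjointness moves each factor \<open>H\<close> onto \<open>y\<close>, where it acts
  as a real scalar, so pairing with \<open>y\<close> turns the matrix exponential series into the
  scalar one.\<close>

lemma cinner_transition_eigenvector:
  fixes H :: "complex ^ 'n ^ 'n"
  assumes "hermitian H" "H *v y = \<theta> *s y" "cnj \<theta> = \<theta>"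
  shows "cinner y (transition H t *v x) = exp (- \<i> * of_real t * \<theta>) * cinner y x"
proof -
  define A where "A = map_matrix (\<lambda>z. - \<i> * of_real t * z) H"
  define c where "c = - \<i> * of_real t * \<theta>"
  have A: "A *v z = (- \<i> * of_real t) *s (H *v z)" for z
    by (simp add: A_def vec_eq_iff matrix_vector_mult_def sum_distrib_left sum_negf mult.assoc)
  have step: "cinner y (A *v z) = c * cinner y z" for z
    by (simp only: A cinner_scale_right cinner_hermitian[OF assms(1)] assms(2) cinner_scale_left
        assms(3) c_def mult.assoc)
  have pow: "cinner y (((**) A ^^ k) (mat 1) *v x) = c ^ k * cinner y x" for k
    by (induction k) (simp_all add: matrix_vector_mul_assoc[symmetric] step)
  \<comment> \<open>Real linearity in finite dimension gives boundedness, so the pairing passes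
    through the series.\<close>
  let ?L = "\<lambda>M. cinner y (M *v x)"
  have "linear ?L"
    by (rule linearI)
      (simp_all add: matrix_vector_mult_add_rdistrib cinner_add_right cinner_def
        matrix_vector_mult_def scaleR_sum_right sum_distrib_left algebra_simps sum.distrib)
  then have "bounded_linear ?L" by (rule linear_conv_bounded_linear[THEN iffD1])
  from bounded_linear.sums[OF this mexp_sums[of A]]
  have "(\<lambda>k. ?L ((1 / fact k) *\<^sub>R (((**) A ^^ k) (mat 1)))) sums ?L (mexp A)" .
  moreover have "?L ((1 / fact k) *\<^sub>R (((**) A ^^ k) (mat 1))) = (c ^ k /\<^sub>R fact k) * cinner y x" for k
    using linear_cmul[OF \<open>linear ?L\<close>] pow by (simp add: divide_inverse)
  ultimately have "(\<lambda>k. (c ^ k /\<^sub>R fact k) * cinner y x) sums cinner y (mexp A *v x)"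
    by simp
  moreover have "(\<lambda>k. (c ^ k /\<^sub>R fact k) * cinner y x) sums (exp c * cinner y x)"
    by (intro sums_mult2 exp_converges)
  ultimately show ?thesis
    unfolding transition_def A_def c_def by (rule sums_unique2)
qed

lemma cinner_axis: "cinner y (axis a z) = cnj (y $ a) * z"
  by (simp add: cinner_def axis_def if_distrib cong: if_cong)

lemma algebraic_eigenvector_exists:
  fixes H :: "complex ^ 'n ^ 'n"
  assumes H: "\<And>u v. algebraic (H $ u $ v)" and \<theta>: "\<theta> \<in> eigenvalue_support H a"
  obtains y where "H *v y = \<theta> *s y" "\<And>i. algebraic (y $ i)" "y $ a = 1"
proof -
  define w where "w = eigenprojection H \<theta> *v axis a 1"
  have w: "H *v w = \<theta> *s w" "cinner w (axis a 1 - w) = 0"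
    using is_orth_proj_eigenprojection[of H \<theta>]
    by (auto simp: is_orth_proj_def w_def eigenspace_def)
  have "w \<noteq> 0" using \<theta> by (simp add: eigenvalue_support_def w_def)
  then have "cinner w w \<noteq> 0" using cinner_self_eq_0 by blast
  then have wa: "w $ a \<noteq> 0"
    using w(2) by (auto simp: cinner_diff_right cinner_axis)
  have alg: "algebraic \<theta>"
    using \<theta> by (intro algebraic_eigenvalue[OF H]) (simp add: eigenvalue_support_def)
  \<comment> \<open>After this scaling the normalization is a relation with algebraic right-hand
    side 1, so it transfers to \<open>y\<close> along with the eigenvector equations.\<close>
  define x where "x i = w $ i / w $ a" for i
  have xa: "x a = 1" using wa by (simp add: x_def)
  have "\<exists>y. (\<forall>i\<in>UNIV. algebraic (y i)) \<and>
      (\<forall>c d. algebraic d \<longrightarrow> (\<forall>i\<in>UNIV. algebraic (c i)) \<longrightarrow>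
        (\<Sum>i\<in>UNIV. c i * x i) = d \<longrightarrow> (\<Sum>i\<in>UNIV. c i * y i) = d)"
    by (rule algebraic_solution_exists) simp
  then obtain y where y: "\<forall>i\<in>UNIV. algebraic (y i)"
    "\<forall>c d. algebraic d \<longrightarrow> (\<forall>i\<in>UNIV. algebraic (c i)) \<longrightarrow>
      (\<Sum>i\<in>UNIV. c i * x i) = d \<longrightarrow> (\<Sum>i\<in>UNIV. c i * y i) = d"
    by (elim exE conjE)
  show ?thesis
  proof (rule that[of "\<chi> i. y i"])
    have "(\<Sum>i\<in>UNIV. (if i = a then 1 else 0) * y i) = 1"
    proof (rule y(2)[rule_format])
      show "(\<Sum>i\<in>UNIV. (if i = a then 1 else 0) * x i) = 1"
        by (simp add: xa if_distrib[of "\<lambda>z. z * _"] cong: if_cong)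
    qed auto
    then show "(\<chi> i. y i) $ a = 1"
      by (simp add: if_distrib[of "\<lambda>z. z * _"] cong: if_cong)
    \<comment> \<open>Each row of the eigenvector equation is homogeneous and therefore survives the
      scaling from \<open>w\<close> to \<open>x\<close>.\<close>
    have "(\<Sum>i\<in>UNIV. (H $ j $ i - (if i = j then \<theta> else 0)) * y i) = 0" for j
    proof (rule y(2)[rule_format])
      have "(\<Sum>i\<in>UNIV. H $ j $ i * w $ i) = \<theta> * w $ j"
        using arg_cong[OF w(1), of "\<lambda>v. v $ j"] by (simp add: matrix_vector_mult_def)
      then have "(\<Sum>i\<in>UNIV. (H $ j $ i - (if i = j then \<theta> else 0)) * w $ i) = 0"
        by (simp add: left_diff_distrib sum_subtractf if_distrib[of "\<lambda>z. z * _"] cong: if_cong)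
      then show "(\<Sum>i\<in>UNIV. (H $ j $ i - (if i = j then \<theta> else 0)) * x i) = 0"
        by (simp add: x_def sum_divide_distrib[symmetric])
    qed (use H alg in auto)
    then show "H *v (\<chi> i. y i) = \<theta> *s (\<chi> i. y i)"
      by (simp add: vec_eq_iff matrix_vector_mult_def left_diff_distrib sum_subtractf
          if_distrib[of "\<lambda>z. z * _"] cong: if_cong)
  qed (use y in auto)
qed

section \<open>Cancelling the exponentials\<close>

theorem theorem4p2:
  fixes H :: "complex ^ 'n ^ 'n" and E :: "('n \<times> 'n) set"
    and a b :: 'n and \<tau> :: real and \<alpha> :: complex and k :: "complex \<Rightarrow> int"
  assumes "hermitian H"
    and "\<And>u v. algebraic (H $ u $ v)"
    and "assoc_hermitian_graph E H"
    and "perfect_state_transfer H a b \<tau> \<alpha>"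
    and "(\<Sum>\<theta>\<in>eigenvalue_support H a. of_int (k \<theta>) * \<theta>) = 0"
    and "(\<Sum>\<theta>\<in>eigenvalue_support H a. k \<theta>) \<noteq> 0"
  shows "algebraic \<alpha>"
proof -
  let ?\<Phi> = "eigenvalue_support H a"
  have "\<exists>c. algebraic c \<and> c * \<alpha> = exp (- \<i> * of_real \<tau> * \<theta>)" if \<theta>: "\<theta> \<in> ?\<Phi>" for \<theta>
  proof -
    obtain y where y: "H *v y = \<theta> *s y" "\<And>i. algebraic (y $ i)" "y $ a = 1"
      using algebraic_eigenvector_exists[OF assms(2) \<theta>] by blast
    have "cnj \<theta> = \<theta>"
      using \<theta> assms(1) by (intro eigenvalue_real) (auto simp: eigenvalue_support_def)
    from cinner_transition_eigenvector[OF assms(1) y(1) this, of \<tau> "axis a 1"]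
    have "cnj (y $ b) * \<alpha> = exp (- \<i> * of_real \<tau> * \<theta>)"
      using assms(4) y(3)
      by (simp add: perfect_state_transfer_def cinner_scale_right cinner_axis mult.commute)
    then show ?thesis using y(2) by blast
  qed
  then obtain c where c: "\<And>\<theta>. \<theta> \<in> ?\<Phi> \<Longrightarrow> algebraic (c \<theta>)"
    "\<And>\<theta>. \<theta> \<in> ?\<Phi> \<Longrightarrow> c \<theta> * \<alpha> = exp (- \<i> * of_real \<tau> * \<theta>)"
    by metis
  have fin: "finite ?\<Phi>"
    using finite_eigenvalues[OF assms(1)] by (simp add: eigenvalue_support_def)
  have "\<alpha> \<noteq> 0" using assms(4) by (auto simp: perfect_state_transfer_def)
  have \<alpha>_sum: "(\<Prod>\<theta>\<in>S. \<alpha> powi k \<theta>) = \<alpha> powi (\<Sum>\<theta>\<in>S. k \<theta>)" if "finite S" for S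
    using that
    by (induction S rule: finite_induct) (simp_all add: power_int_add \<open>\<alpha> \<noteq> 0\<close>)
  define p where "p = (\<Prod>\<theta>\<in>?\<Phi>. c \<theta> powi k \<theta>)"
  \<comment> \<open>A zero exponent gives 1 and is treated apart, since the equivalence for integer
    powers assumes a nonzero exponent.\<close>
  have "algebraic (c \<theta> powi k \<theta>)" if "\<theta> \<in> ?\<Phi>" for \<theta>
    using c(1)[OF that] algebraic_power_int_iff[of "k \<theta>" "c \<theta>"] by (cases "k \<theta> = 0") auto
  then have "algebraic p" unfolding p_def by blast
  have "p * \<alpha> powi (\<Sum>\<theta>\<in>?\<Phi>. k \<theta>) = (\<Prod>\<theta>\<in>?\<Phi>. (c \<theta> * \<alpha>) powi k \<theta>)"
    using fin by (simp add: p_def \<alpha>_sum[symmetric] prod.distrib power_int_mult_distrib)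
  also have "\<dots> = (\<Prod>\<theta>\<in>?\<Phi>. exp (of_int (k \<theta>) * (- \<i> * of_real \<tau> * \<theta>)))"
    by (intro prod.cong refl) (simp only: c(2) exp_power_int)
  also have "\<dots> = exp ((- \<i> * of_real \<tau>) * (\<Sum>\<theta>\<in>?\<Phi>. of_int (k \<theta>) * \<theta>))"
    by (simp only: exp_sum[OF fin, symmetric] sum_distrib_left mult_ac)
  finally have "p * \<alpha> powi (\<Sum>\<theta>\<in>?\<Phi>. k \<theta>) = 1"
    by (simp add: assms(5))
  then have "\<alpha> powi (\<Sum>\<theta>\<in>?\<Phi>. k \<theta>) = inverse p"
    by (metis inverse_unique)
  \<comment> \<open>The total exponent is nonzero, so algebraicity descends from the power to
    \<alpha> itself.\<close>
  then show ?thesis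
    using \<open>algebraic p\<close> assms(6) algebraic_power_int_iff algebraic_inverse by metis
qed

end
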